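(* Let $G$ be a profinite group which is not countably based. Then $|\mathcal{S}(G)|=|\mathcal{N}(G)|=2^{w(G)}$.
   Context: $\mathcal{S}(G)$ is the set of closed subgroups of $G$ and $\mathcal{N}(G)$ is the set of closed normal subgroups of $G$. $w(G)$ is the weight of $G$: the least cardinality of a base for the topology of $G$. Countably based means having a countable base for the topology. *)

theory Defs
  imports "HOL-Analysis.Analysis" "HOL-Algebra.Coset"
begin

unbundle cardinal_syntax

definition topological_group :: "('a, 'b) monoid_scheme \<Rightarrow> 'a topology \<Rightarrow> bool" where
  "topological_group G T \<longleftrightarrow>
     group G \<and> topspace T = carrier G \<and>
     continuous_map (prod_topology T T) T (\<lambda>(x, y). x \<otimes>\<^bsub>G\<^esub> y) \<and>
     continuous_map T T (\<lambda>x. inv\<^bsub>G\<^esub> x)"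

definition totally_disconnected_space :: "'a topology \<Rightarrow> bool" where
  "totally_disconnected_space T \<longleftrightarrow>
     (\<forall>x \<in> topspace T. connected_component_of_set T x = {x})"

definition profinite_group :: "('a, 'b) monoid_scheme \<Rightarrow> 'a topology \<Rightarrow> bool" where
  "profinite_group G T \<longleftrightarrow>
     topological_group G T \<and> compact_space T \<and> Hausdorff_space T \<and>
     totally_disconnected_space T"

definition closed_subgroups :: "('a, 'b) monoid_scheme \<Rightarrow> 'a topology \<Rightarrow> 'a set set" where
  "closed_subgroups G T = {H. subgroup H G \<and> closedin T H}"

definition closed_normal_subgroups :: "('a, 'b) monoid_scheme \<Rightarrow> 'a topology \<Rightarrow> 'a set set" where
  "closed_normal_subgroups G T = {N. N \<lhd> G \<and> closedin T N}"

(* Same notion of base as the one inlined in the library's second_countable. *)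
definition topology_base :: "'a topology \<Rightarrow> 'a set set \<Rightarrow> bool" where
  "topology_base T \<B> \<longleftrightarrow>
     (\<forall>V \<in> \<B>. openin T V) \<and>
     (\<forall>U x. openin T U \<and> x \<in> U \<longrightarrow> (\<exists>V \<in> \<B>. x \<in> V \<and> V \<subseteq> U))"

(* Cardinals are well-orders up to =o; the weight is represented by the
   canonical cardinal of a base that has least cardinality among all bases.
   The choice is justified, and irrelevant up to =o, by weight_attained and
   weight_least below. *)
definition weight :: "'a topology \<Rightarrow> 'a set rel" where
  "weight T =
     |SOME \<B>. topology_base T \<B> \<and> (\<forall>\<B>'. topology_base T \<B>' \<longrightarrow> |\<B>| \<le>o |\<B>'| )|"

lemma second_countable_iff_base:
  "second_countable T \<longleftrightarrow> (\<exists>\<B>. countable \<B> \<and> topology_base T \<B>)"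
  unfolding second_countable_def topology_base_def by simp

lemma least_base_exists:
  "\<exists>\<B>. topology_base T \<B> \<and> (\<forall>\<B>'. topology_base T \<B>' \<longrightarrow> |\<B>| \<le>o |\<B>'| )"
proof -
  let ?R = "card_of ` {\<B>. topology_base T \<B>}"
  have "topology_base T {U. openin T U}"
    unfolding topology_base_def by blast
  then have "?R \<noteq> {}" by blast
  moreover have "\<forall>r \<in> ?R. Card_order r" by (auto simp: card_of_Card_order)
  ultimately have "\<exists>r \<in> ?R. \<forall>r' \<in> ?R. r \<le>o r'" by (rule exists_minim_Card_order)
  then show ?thesis by blast
qed

lemma weight_attained: "\<exists>\<B>. topology_base T \<B> \<and> weight T = |\<B>|"
  unfolding weight_def using someI_ex[OF least_base_exists[of T]] by blast

lemma weight_least: "topology_base T \<B> \<Longrightarrow> weight T \<le>o |\<B>|"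
  unfolding weight_def using someI_ex[OF least_base_exists[of T]] by blast

end

theory Submission
  imports Defs "HOL-Algebra.SndIsomorphismGrp"
begin

text \<open>
  A closed subset is determined by the members of a base that are disjoint from it, so there are at
  most \<open>2^w(G)\<close> closed subgroups. The content of the theorem is that \<open>2^w(G)\<close> of the closed
  subgroups are normal. Let \<open>\<kappa>\<close> be the number of open normal subgroups. Their cosets form a
  base (\<open>topology_base_open_cosets\<close>) and each of them has finite index, so \<open>w(G) \<le> \<kappa>\<close>, and
  \<open>\<kappa>\<close> is uncountable when \<open>G\<close> is not countably based. It therefore suffices to produce
  \<open>2^\<kappa>\<close> closed normal subgroups.

  Suppose first that one open normal subgroup \<open>N\<close> had \<open>\<kappa>\<close> many maximal \<open>G\<close>-normal open
  subgroups \<open>K\<close>. Since each \<open>N/K\<close> is a chief factor, the modular law gives an exchange property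
  for the relation ``\<open>K\<close> contains the intersection of a given family'' (\<open>exchange\<close>), as for
  hyperplanes of a vector space. A maximal independent family of such \<open>K\<close> then has \<open>\<kappa>\<close>
  members, and its subfamilies have \<open>2^\<kappa>\<close> distinct intersections.

  Such an \<open>N\<close> need not exist when \<open>\<kappa>\<close> is singular, but a family \<open>\<P>\<close> of fewer than
  \<open>\<kappa>\<close> open normal subgroups having \<open>\<kappa>\<close> many maximal \<open>G\<close>-normal subgroups between them
  always does. The reason is that every open normal subgroup is reached from \<open>G\<close> by finitely many
  steps of passing to a maximal \<open>G\<close>-normal subgroup: either some level of this process is the first
  with \<open>\<kappa>\<close> members and the previous level serves as \<open>\<P>\<close>, or \<open>\<kappa>\<close> has countable
  cofinality and a countable \<open>\<P>\<close> is enough (\<open>small_set_with_large_neighbourhood\<close>). The exchange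
  argument is now carried out below the closed normal subgroup \<open>H = \<Inter>\<P>\<close>. It yields a
  maximal family \<open>\<M>\<close> that is independent modulo \<open>H\<close>, and every one of the \<open>\<kappa>\<close>
  maximal subgroups contains \<open>H \<inter> \<Inter>\<M>\<close>. By compactness at most
  \<open>|\<P>| + |\<M>| + \<aleph>\<^sub>0\<close> open normal subgroups do so
  (\<open>card_of_open_normal_above_meet\<close>). As \<open>|\<P>| < \<kappa>\<close>, it follows that
  \<open>|\<M>| \<ge> \<kappa>\<close>, and the intersections \<open>H \<inter> \<Inter>\<S>\<close> for
  \<open>\<S> \<subseteq> \<M>\<close> are pairwise distinct.
\<close>

section \<open>Cardinal arithmetic\<close>

lemma card_of_less_iff_not_ge: "|A| <o |B| \<longleftrightarrow> \<not> |B| \<le>o |A|"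
  by (simp add: card_of_Well_order not_ordLeq_iff_ordLess)

lemma card_of_countable_less_uncountable:
  assumes "countable A" "\<not> countable B"
  shows "|A| <o |B|"
proof -
  have "\<not> |B| \<le>o |A|"
  proof
    assume "|B| \<le>o |A|"
    then obtain f where f: "inj_on f B" "f ` B \<subseteq> A"
      unfolding card_of_ordLeq[symmetric] by blast
    have "countable (f ` B)" using f(2) assms(1) by (rule countable_subset)
    then have "countable B" using f(1) by (rule countable_image_inj_on)
    then show False using assms(2) by blast
  qed
  then show ?thesis by (simp add: card_of_less_iff_not_ge)
qed

lemma card_of_finite_le_infinite:
  assumes "finite A" "infinite B"
  shows "|A| \<le>o |B|"
proof (rule ccontr)
  assume "\<not> |A| \<le>o |B|"
  then have "|B| <o |A|" by (simp only: card_of_less_iff_not_ge not_False_eq_True)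
  then have "|B| \<le>o |A|" by (rule ordLess_imp_ordLeq)
  then have "finite B" using assms(1) by (rule card_of_ordLeq_finite)
  then show False using assms(2) by blast
qed

lemma card_of_Pow_mono:
  assumes "|A| \<le>o |B|"
  shows "|Pow A| \<le>o |Pow B|"
proof -
  obtain f where f: "inj_on f A" "f ` A \<subseteq> B"
    using assms unfolding card_of_ordLeq[symmetric] by blast
  have "inj_on (image f) (Pow A)" using f(1) by (rule inj_on_image_Pow)
  moreover have "image f ` Pow A \<subseteq> Pow B" using f(2) by blast
  ultimately show ?thesis unfolding card_of_ordLeq[symmetric] by blast
qed

lemma card_of_Pow_eq_cexp_ctwo: "|Pow A| =o ctwo ^c |A|"
  unfolding ctwo_def cexp_def Field_card_of by (rule card_of_Pow_Func)

text \<open>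
  Bounds by an infinite set are closed under finite subsets and unions; this supplies such a bound
  when the set to be measured may itself be finite.
\<close>

lemma infinite_superset_of_smaller_card:
  fixes A B :: "'x set"
  assumes "\<not> countable B" "|A| <o |B|"
  obtains C where "A \<subseteq> C" "infinite C" "|C| <o |B|"
proof -
  have "infinite B" using assms(1) countable_finite by blast
  then obtain Z where Z: "Z \<subseteq> B" "countable Z" "infinite Z"
    using infinite_countable_subset' by blast
  have "|A \<union> Z| <o |B|"
    using card_of_Un_ordLess_infinite[OF \<open>infinite B\<close> assms(2)]
      card_of_countable_less_uncountable[OF Z(2) assms(1)] by blast
  then show thesis using that[of "A \<union> Z"] Z by auto
qed

text \<open>
  By induction on \<open>n\<close> there are at most \<open>|B|\<close> subsets of size \<open>n\<close>, since such a set arises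
  from a smaller one by inserting one element; then take the union over the countably many \<open>n\<close>.
\<close>

lemma card_of_finite_subsets_le:
  assumes "infinite B" "|A| \<le>o |B|"
  shows "|{F. F \<subseteq> A \<and> finite F}| \<le>o |B|"
proof -
  have *: "|{F. F \<subseteq> A \<and> finite F \<and> card F = n}| \<le>o |B|" for n
  proof (induction n)
    case 0
    have "{F. F \<subseteq> A \<and> finite F \<and> card F = 0} = {{}}" by auto
    then show ?case using assms(1) by (simp add: card_of_finite_le_infinite)
  next
    case (Suc n)
    let ?P = "{F. F \<subseteq> A \<and> finite F \<and> card F = n}"
    have "{F. F \<subseteq> A \<and> finite F \<and> card F = Suc n} \<subseteq> (\<Union>F\<in>?P. (\<lambda>a. insert a F) ` A)"
    proof
      fix F assume "F \<in> {F. F \<subseteq> A \<and> finite F \<and> card F = Suc n}"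
      then obtain a E where "F = insert a E" "a \<notin> E" "F \<subseteq> A" "card E = n" "finite E"
        by (auto simp: card_Suc_eq_finite)
      then show "F \<in> (\<Union>F\<in>?P. (\<lambda>a. insert a F) ` A)" by auto
    qed
    moreover have "|\<Union>F\<in>?P. (\<lambda>a. insert a F) ` A| \<le>o |B|"
      using Suc assms ordLeq_transitive[OF card_of_image assms(2)]
      by (intro card_of_UNION_ordLeq_infinite) auto
    ultimately show ?case using card_of_mono1 ordLeq_transitive by blast
  qed
  have "{F. F \<subseteq> A \<and> finite F} = (\<Union>n\<in>(UNIV::nat set). {F. F \<subseteq> A \<and> finite F \<and> card F = n})"
    by auto
  moreover have "|\<Union>n\<in>(UNIV::nat set). {F. F \<subseteq> A \<and> finite F \<and> card F = n}| \<le>o |B|"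
    using * assms(1) by (intro card_of_UNION_ordLeq_infinite) (auto simp: infinite_iff_card_of_nat)
  ultimately show ?thesis by simp
qed

text \<open>
  Think of \<open>L n\<close> as the vertices reached from a finite set by \<open>n\<close> steps in a directed graph
  with \<open>\<kappa>\<close> vertices. If some level has \<open>\<kappa>\<close> points, the level before the first such one is a
  small set with \<open>\<kappa>\<close> successors. Otherwise all levels are smaller than \<open>\<kappa>\<close>, and for each
  \<open>n\<close> some vertex has at least \<open>|L n|\<close> successors: if not, \<open>|L n|\<close> would bound all
  out-degrees, so every level would have at most \<open>|L n| + \<aleph>\<^sub>0 < \<kappa>\<close> points, and hence so
  would their union. Countably many such vertices have at least \<open>sup |L n| = \<kappa>\<close> successors.
\<close>

lemma small_set_with_large_neighbourhood:
  fixes L :: "nat \<Rightarrow> 'x set" and succs :: "'x \<Rightarrow> 'x set"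
  assumes unc: "\<not> countable (\<Union>n. L n)"
    and L0: "finite (L 0)"
    and LSuc: "\<And>n. L (Suc n) = (\<Union>x\<in>L n. succs x)"
  shows "\<exists>X \<subseteq> (\<Union>n. L n). |X| <o |\<Union>n. L n| \<and> |\<Union>n. L n| \<le>o |\<Union>x\<in>X. succs x|"
proof -
  let ?U = "\<Union>n. L n"
  show ?thesis
  proof (cases "\<exists>n. |?U| \<le>o |L n|")
    case True
    define n where "n = (LEAST n. |?U| \<le>o |L n| )"
    have n: "|?U| \<le>o |L n|" using True unfolding n_def by (rule LeastI_ex)
    have "n \<noteq> 0"
    proof
      assume "n = 0"
      then have "finite ?U" using n L0 card_of_ordLeq_finite by blast
      then show False using unc countable_finite by blast
    qed
    then obtain m where m: "n = Suc m" using not0_implies_Suc by blast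
    have "\<not> |?U| \<le>o |L m|" using not_less_Least[of m "\<lambda>n. |?U| \<le>o |L n|"] m n_def by auto
    then have "|L m| <o |?U|" by (simp add: card_of_less_iff_not_ge)
    moreover have "|?U| \<le>o |\<Union>x\<in>L m. succs x|" using n unfolding m LSuc .
    ultimately show ?thesis by (intro exI[of _ "L m"]) blast
  next
    case False
    have pick: "\<exists>x \<in> ?U. |L n| \<le>o |succs x|" for n
    proof (rule ccontr)
      assume "\<not> ?thesis"
      then have small: "|succs x| \<le>o |L n|" if "x \<in> ?U" for x
        using that by (metis card_of_less_iff_not_ge ordLess_imp_ordLeq)
      have "|L n| <o |?U|" using False by (simp add: card_of_less_iff_not_ge)
      then obtain B where B: "L n \<subseteq> B" "infinite B" "|B| <o |?U|"
        using infinite_superset_of_smaller_card[OF unc] by blast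
      have "|L m| \<le>o |B|" for m
      proof (induction m)
        case 0
        then show ?case using L0 B(2) by (intro card_of_finite_le_infinite)
      next
        case (Suc m)
        have "|succs x| \<le>o |B|" if "x \<in> L m" for x
          using small[of x] that card_of_mono1[OF B(1)] ordLeq_transitive by blast
        then show ?case unfolding LSuc using Suc B(2)
          by (intro card_of_UNION_ordLeq_infinite) auto
      qed
      then have "|?U| \<le>o |B|" using B(2)
        by (intro card_of_UNION_ordLeq_infinite) (auto simp: infinite_iff_card_of_nat)
      then show False using B(3) card_of_less_iff_not_ge by blast
    qed
    then obtain x where x: "\<And>n. x n \<in> ?U" "\<And>n. |L n| \<le>o |succs (x n)|" by metis
    let ?W = "\<Union>y\<in>range x. succs y"
    have LW: "|L n| \<le>o |?W|" for n
      using x(2)[of n] card_of_mono1[of "succs (x n)" ?W] ordLeq_transitive by blast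
    have "infinite ?W"
    proof
      assume "finite ?W"
      then have "finite (L n)" for n using LW card_of_ordLeq_finite by blast
      then show False using unc by (simp add: countable_finite)
    qed
    then have "|?U| \<le>o |?W|" using LW
      by (intro card_of_UNION_ordLeq_infinite) (auto simp: infinite_iff_card_of_nat)
    moreover have "|range x| <o |?U|"
      using unc by (intro card_of_countable_less_uncountable) auto
    ultimately show ?thesis using x(1) by (intro exI[of _ "range x"]) auto
  qed
qed

section \<open>Open normal subgroups of a compact group\<close>

locale compact_group = group +
  fixes T :: "'a topology"
  assumes topspace_eq: "topspace T = carrier G"
    and continuous_mult: "continuous_map (prod_topology T T) T (\<lambda>(x, y). x \<otimes> y)"
    and compact: "compact_space T"
begin

lemma openin_r_coset:
  assumes "openin T U" "a \<in> carrier G"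
  shows "openin T (U #> a)"
proof -
  have U: "U \<subseteq> carrier G" using assms(1) openin_subset topspace_eq by blast
  have "continuous_map T (prod_topology T T) (\<lambda>x. (x, inv a))"
    using assms(2) topspace_eq by (intro continuous_map_pairedI) auto
  then have "continuous_map T T ((\<lambda>(x, y). x \<otimes> y) \<circ> (\<lambda>x. (x, inv a)))"
    using continuous_mult by (rule continuous_map_compose)
  then have "continuous_map T T (\<lambda>x. x \<otimes> inv a)" by (simp add: o_def)
  then have "openin T {x \<in> topspace T. x \<otimes> inv a \<in> U}"
    using assms(1) by (rule openin_continuous_map_preimage)
  moreover have "{x \<in> topspace T. x \<otimes> inv a \<in> U} = U #> a"
  proof (intro equalityI subsetI)
    fix x assume "x \<in> {x \<in> topspace T. x \<otimes> inv a \<in> U}"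
    then have "x \<in> carrier G" "x \<otimes> inv a \<in> U" by (auto simp: topspace_eq)
    moreover have "x = (x \<otimes> inv a) \<otimes> a"
      using \<open>x \<in> carrier G\<close> assms(2) by (simp add: m_assoc)
    ultimately show "x \<in> U #> a" unfolding r_coset_def by blast
  next
    fix x assume "x \<in> U #> a"
    then obtain u where "u \<in> U" "x = u \<otimes> a" unfolding r_coset_def by blast
    then show "x \<in> {x \<in> topspace T. x \<otimes> inv a \<in> U}"
      using U assms(2) by (auto simp: topspace_eq m_assoc subset_iff)
  qed
  ultimately show ?thesis by simp
qed

text \<open>
  An overgroup is a union of cosets of the smaller subgroup.
\<close>

lemma openin_overgroup:
  assumes "subgroup K G" "openin T K" "subgroup D G" "K \<subseteq> D"
  shows "openin T D"
proof -
  have "D = (\<Union>d\<in>D. K #> d)"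
  proof (intro equalityI subsetI)
    fix d assume "d \<in> D"
    then show "d \<in> (\<Union>d\<in>D. K #> d)"
      using rcos_self[OF _ assms(1)] subgroup.subset[OF assms(3)] by blast
  next
    fix x assume "x \<in> (\<Union>d\<in>D. K #> d)"
    then show "x \<in> D"
      using assms(3,4) by (auto simp: r_coset_def subgroup.m_closed subset_iff)
  qed
  moreover have "openin T (\<Union>d\<in>D. K #> d)"
    using openin_r_coset[OF assms(2)] subgroup.subset[OF assms(3)] by auto
  ultimately show ?thesis by simp
qed

lemma openin_rcosets:
  assumes "openin T K" "c \<in> rcosets K"
  shows "openin T c"
  using assms openin_r_coset by (auto simp: RCOSETS_def)

lemma closedin_open_subgroup:
  assumes "subgroup K G" "openin T K"
  shows "closedin T K"
proof -
  have "K \<in> rcosets K"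
    using subgroup.subgroup_in_rcosets[OF assms(1) is_group] .
  have "topspace T - K = \<Union>(rcosets K - {K})"
  proof (intro equalityI subsetI)
    fix x assume "x \<in> topspace T - K"
    then show "x \<in> \<Union>(rcosets K - {K})"
      using rcosets_part_G[OF assms(1)] unfolding topspace_eq by blast
  next
    fix x assume "x \<in> \<Union>(rcosets K - {K})"
    then obtain c where c: "c \<in> rcosets K" "c \<noteq> K" "x \<in> c" by blast
    then have "x \<in> carrier G" using rcosets_part_G[OF assms(1)] by blast
    moreover have "c \<inter> K = {}"
      using pairwiseD[OF rcos_disjoint[OF assms(1)] c(1) \<open>K \<in> rcosets K\<close> c(2)]
      unfolding disjnt_def .
    ultimately show "x \<in> topspace T - K" using c(3) unfolding topspace_eq by blast
  qed
  moreover have "openin T (\<Union>(rcosets K - {K}))"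
    using openin_rcosets[OF assms(2)] by auto
  ultimately show ?thesis
    using openin_subset[OF assms(2)] by (simp add: closedin_def)
qed

lemma finite_rcosets_open_subgroup:
  assumes "subgroup K G" "openin T K"
  shows "finite (rcosets K)"
proof -
  have "\<forall>c\<in>rcosets K. openin T c" using openin_rcosets[OF assms(2)] by blast
  then obtain \<F> where \<F>: "finite \<F>" "\<F> \<subseteq> rcosets K" "\<Union>\<F> = carrier G"
    using compact rcosets_part_G[OF assms(1)] unfolding compact_space topspace_eq by meson
  have "rcosets K \<subseteq> \<F>"
  proof
    fix c assume c: "c \<in> rcosets K"
    then obtain x where x: "x \<in> carrier G" "c = K #> x" unfolding RCOSETS_def by blast
    then have "x \<in> c" using rcos_self[OF _ assms(1)] by simp
    obtain d where d: "d \<in> \<F>" "x \<in> d" using \<F>(3) x(1) by blast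
    then have "c = d"
      using pairwiseD[OF rcos_disjoint[OF assms(1)] c, of d] \<F>(2) \<open>x \<in> c\<close>
      unfolding disjnt_def by blast
    then show "c \<in> \<F>" using d(1) by simp
  qed
  then show ?thesis using \<F>(1) by (rule finite_subset)
qed

text \<open>
  An overgroup of \<open>K\<close> is determined by the cosets of \<open>K\<close> that it contains, and there are
  only finitely many cosets.
\<close>

lemma finite_overgroups:
  assumes "subgroup K G" "openin T K"
  shows "finite {M. subgroup M G \<and> K \<subseteq> M}"
proof (rule inj_on_finite)
  let ?f = "\<lambda>M. {c \<in> rcosets K. c \<subseteq> M}"
  have "\<Union>(?f M) = M" if M: "subgroup M G" "K \<subseteq> M" for M
  proof (intro equalityI subsetI)
    fix m assume m: "m \<in> M"
    then have "m \<in> carrier G" using subgroup.subset[OF M(1)] by blast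
    then have "K #> m \<in> rcosets K" "m \<in> K #> m"
      using rcos_self[OF _ assms(1)] by (auto simp: RCOSETS_def)
    moreover have "K #> m \<subseteq> M"
      using M m by (auto simp: r_coset_def subgroup.m_closed subset_iff)
    ultimately show "m \<in> \<Union>(?f M)" by blast
  qed auto
  then show "inj_on ?f {M. subgroup M G \<and> K \<subseteq> M}"
    by (intro inj_onI) (metis (no_types, lifting) mem_Collect_eq)
  show "?f ` {M. subgroup M G \<and> K \<subseteq> M} \<subseteq> Pow (rcosets K)" by auto
  show "finite (Pow (rcosets K))" using finite_rcosets_open_subgroup[OF assms] by simp
qed

definition open_normal :: "'a set set" where
  "open_normal = {N. N \<lhd> G \<and> openin T N}"

text \<open>
  Intersecting with the carrier makes the empty family intersect in the whole group.
\<close>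

definition meet :: "'a set set \<Rightarrow> 'a set" where
  "meet \<F> = carrier G \<inter> \<Inter>\<F>"

lemma open_normalD:
  assumes "N \<in> open_normal"
  shows "N \<lhd> G" "subgroup N G" "openin T N" "closedin T N" "N \<subseteq> carrier G"
proof -
  show 1: "N \<lhd> G" and 2: "openin T N" using assms unfolding open_normal_def by auto
  show 3: "subgroup N G" using 1 by (rule normal_imp_subgroup)
  show "closedin T N" using 3 2 by (rule closedin_open_subgroup)
  show "N \<subseteq> carrier G" using 3 by (rule subgroup.subset)
qed

lemma carrier_open_normal: "carrier G \<in> open_normal"
proof -
  have "carrier G \<lhd> G" by (rule normal_invI) (auto intro: subgroup_self)
  then show ?thesis unfolding open_normal_def
    using openin_topspace[of T] by (simp add: topspace_eq)
qed

lemma normal_meet: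
  assumes "\<And>N. N \<in> \<F> \<Longrightarrow> N \<lhd> G"
  shows "meet \<F> \<lhd> G"
proof (rule normal_invI)
  have sub: "subgroup N G" if "N \<in> \<F>" for N using assms[OF that] by (rule normal_imp_subgroup)
  show "subgroup (meet \<F>) G"
  proof (rule subgroup.intro)
    show "meet \<F> \<subseteq> carrier G" unfolding meet_def by blast
    show "\<one> \<in> meet \<F>" by (auto simp: meet_def subgroup.one_closed[OF sub])
    show "x \<otimes> y \<in> meet \<F>" if "x \<in> meet \<F>" "y \<in> meet \<F>" for x y
      using that by (auto simp: meet_def subgroup.m_closed[OF sub])
    show "inv x \<in> meet \<F>" if "x \<in> meet \<F>" for x
      using that by (auto simp: meet_def subgroup.m_inv_closed[OF sub])
  qed
  show "x \<otimes> h \<otimes> inv x \<in> meet \<F>" if "x \<in> carrier G" "h \<in> meet \<F>" for x h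
    using that assms by (auto simp: meet_def normal.inv_op_closed2)
qed

lemma closedin_meet:
  assumes "\<F> \<subseteq> open_normal"
  shows "closedin T (meet \<F>)"
proof -
  have "meet \<F> = \<Inter>(insert (topspace T) \<F>)" by (auto simp: meet_def topspace_eq)
  moreover have "closedin T (\<Inter>(insert (topspace T) \<F>))"
    using assms open_normalD(4) by (intro closedin_Inter) auto
  ultimately show ?thesis by simp
qed

lemma meet_closed_normal:
  assumes "\<F> \<subseteq> open_normal"
  shows "meet \<F> \<in> closed_normal_subgroups G T"
proof -
  have "meet \<F> \<lhd> G" using assms open_normalD(1) by (intro normal_meet) blast
  then show ?thesis
    using closedin_meet[OF assms] unfolding closed_normal_subgroups_def by simp
qed

lemma finite_meet_open_normal:
  assumes "finite \<F>" "\<F> \<subseteq> open_normal"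
  shows "meet \<F> \<in> open_normal"
proof -
  have "meet \<F> = \<Inter>(insert (topspace T) \<F>)" by (auto simp: meet_def topspace_eq)
  moreover have "openin T (\<Inter>(insert (topspace T) \<F>))"
    using assms open_normalD(3) by (intro openin_Inter) auto
  ultimately have "openin T (meet \<F>)" by simp
  moreover have "meet \<F> \<lhd> G" using assms(2) open_normalD(1) by (intro normal_meet) blast
  ultimately show ?thesis unfolding open_normal_def by simp
qed

text \<open>
  Open subgroups are closed, so their complements together with \<open>U\<close> form an open cover.
\<close>

lemma compact_meet:
  assumes "\<F> \<subseteq> open_normal" "openin T U" "meet \<F> \<subseteq> U"
  obtains \<E> where "finite \<E>" "\<E> \<subseteq> \<F>" "meet \<E> \<subseteq> U"
proof -
  let ?C = "insert U ((\<lambda>K. carrier G - K) ` \<F>)"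
  have "\<forall>V\<in>?C. openin T V"
  proof
    fix V assume "V \<in> ?C"
    then consider "V = U" | K where "K \<in> \<F>" "V = topspace T - K"
      unfolding topspace_eq by blast
    then show "openin T V"
    proof cases
      case 2
      then have "closedin T K" using assms(1) open_normalD(4) by blast
      then show ?thesis unfolding 2(2) by (rule openin_diff[OF openin_topspace])
    qed (use assms(2) in simp)
  qed
  moreover have "topspace T \<subseteq> \<Union>?C"
    using assms(3) unfolding meet_def topspace_eq by auto
  ultimately have "\<exists>\<D>. finite \<D> \<and> \<D> \<subseteq> ?C \<and> topspace T \<subseteq> \<Union>\<D>"
    using compact[unfolded compact_space_alt, rule_format, of ?C] by (simp only: simp_thms)
  then obtain \<D> where \<D>: "finite \<D>" "\<D> \<subseteq> ?C" "carrier G \<subseteq> \<Union>\<D>"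
    unfolding topspace_eq by (elim exE conjE)
  have "finite (\<D> - {U})" "\<D> - {U} \<subseteq> (\<lambda>K. carrier G - K) ` \<F>" using \<D>(1,2) by auto
  from finite_subset_image[OF this]
  obtain \<E> where \<E>: "\<E> \<subseteq> \<F>" "finite \<E>" "\<D> - {U} = (\<lambda>K. carrier G - K) ` \<E>"
    by auto
  have "meet \<E> \<subseteq> U"
  proof
    fix x assume x: "x \<in> meet \<E>"
    then have "x \<in> \<Union>\<D>" using \<D>(3) unfolding meet_def by blast
    then obtain V where "V \<in> \<D>" "x \<in> V" by blast
    show "x \<in> U"
    proof (cases "V = U")
      case False
      then have "V \<in> (\<lambda>K. carrier G - K) ` \<E>" using \<open>V \<in> \<D>\<close> \<E>(3) by blast
      then show ?thesis using \<open>x \<in> V\<close> x unfolding meet_def by blast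
    qed (use \<open>x \<in> V\<close> in simp)
  qed
  then show thesis by (rule that[OF \<E>(2,1)])
qed

text \<open>
  By compactness such a \<open>U\<close> already contains the intersection of a finite subfamily, which is an
  open subgroup and has only finitely many overgroups.
\<close>

lemma card_of_open_normal_above_meet:
  assumes "infinite B" "\<F> \<subseteq> open_normal" "|\<F>| \<le>o |B|"
  shows "|{U \<in> open_normal. meet \<F> \<subseteq> U}| \<le>o |B|"
proof -
  let ?Fin = "{\<E>. \<E> \<subseteq> \<F> \<and> finite \<E>}"
  have "{U \<in> open_normal. meet \<F> \<subseteq> U} \<subseteq> (\<Union>\<E>\<in>?Fin. {U. subgroup U G \<and> meet \<E> \<subseteq> U})"
  proof
    fix U assume "U \<in> {U \<in> open_normal. meet \<F> \<subseteq> U}"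
    then have U: "U \<in> open_normal" "meet \<F> \<subseteq> U" by auto
    obtain \<E> where "finite \<E>" "\<E> \<subseteq> \<F>" "meet \<E> \<subseteq> U"
      by (rule compact_meet[OF assms(2) open_normalD(3)[OF U(1)] U(2)])
    then have "\<E> \<in> ?Fin" "U \<in> {U. subgroup U G \<and> meet \<E> \<subseteq> U}"
      using open_normalD(2)[OF U(1)] by simp_all
    then show "U \<in> (\<Union>\<E>\<in>?Fin. {U. subgroup U G \<and> meet \<E> \<subseteq> U})" by (rule UN_I)
  qed
  moreover have "|\<Union>\<E>\<in>?Fin. {U. subgroup U G \<and> meet \<E> \<subseteq> U}| \<le>o |B|"
  proof (rule card_of_UNION_ordLeq_infinite[OF assms(1)], goal_cases)
    case 1
    show ?case using assms(1,3) by (rule card_of_finite_subsets_le)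
  next
    case 2
    have "|{U. subgroup U G \<and> meet \<E> \<subseteq> U}| \<le>o |B|" if "\<E> \<subseteq> \<F>" "finite \<E>" for \<E>
    proof -
      have "meet \<E> \<in> open_normal"
        using that(2) order_trans[OF that(1) assms(2)] by (rule finite_meet_open_normal)
      then have "finite {U. subgroup U G \<and> meet \<E> \<subseteq> U}"
        using finite_overgroups[OF open_normalD(2,3)] by simp
      then show ?thesis using assms(1) by (rule card_of_finite_le_infinite)
    qed
    then show ?case by simp
  qed
  ultimately show ?thesis by (rule ordLeq_transitive[OF card_of_mono1])
qed

section \<open>Chief factors\<close>

definition maximal_in :: "'a set \<Rightarrow> 'a set set" where
  "maximal_in N = {K \<in> open_normal. K \<subset> N \<and>
     (\<forall>D \<in> open_normal. K \<subseteq> D \<and> D \<subseteq> N \<longrightarrow> D = K \<or> D = N)}"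

text \<open>
  The reason is the isomorphism of \<open>G\<close>-groups \<open>Y/(Y \<inter> K) \<cong> YK/K \<le> N/K\<close>, whose right-hand
  side is simple. Concretely, \<open>DK\<close> lies between \<open>K\<close> and \<open>N\<close>. If it equals \<open>K\<close>,
  then \<open>D \<subseteq> Y \<inter> K\<close>; if it equals \<open>N\<close>, the modular law gives
  \<open>Y = Y \<inter> DK = D(Y \<inter> K) = D\<close>.
\<close>

lemma no_normal_subgroup_between:
  assumes K: "K \<in> maximal_in N" and N: "N \<in> open_normal"
    and Y: "Y \<lhd> G" "Y \<subseteq> N" and D: "D \<lhd> G" "Y \<inter> K \<subseteq> D" "D \<subseteq> Y"
  shows "D = Y \<inter> K \<or> D = Y"
proof -
  have K': "K \<in> open_normal" using K unfolding maximal_in_def by blast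
  note sK = open_normalD(2)[OF K'] and sN = open_normalD(2)[OF N]
    and sD = normal_imp_subgroup[OF D(1)] and sY = normal_imp_subgroup[OF Y(1)]
  have n: "D <#> K \<lhd> G"
    using D(1) open_normalD(1)[OF K'] by (rule normal_subgroup_set_mult_closed)
  have KD: "K \<subseteq> D <#> K"
  proof
    fix k assume "k \<in> K"
    then show "k \<in> D <#> K" unfolding set_mult_def
      using subgroup.one_closed[OF sD] subgroup.mem_carrier[OF sK]
      by (force intro: bexI[of _ \<one>])
  qed
  have DD: "D \<subseteq> D <#> K"
  proof
    fix d assume "d \<in> D"
    then show "d \<in> D <#> K" unfolding set_mult_def
      using subgroup.one_closed[OF sK] subgroup.mem_carrier[OF sD] by force
  qed
  have "openin T (D <#> K)"
    using openin_overgroup[OF sK open_normalD(3)[OF K'] normal_imp_subgroup[OF n] KD] .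
  then have "D <#> K \<in> open_normal" using n unfolding open_normal_def by blast
  moreover have "D <#> K \<subseteq> N"
    using K D(3) Y(2) subgroup.m_closed[OF sN] unfolding set_mult_def maximal_in_def by blast
  ultimately consider "D <#> K = K" | "D <#> K = N"
    using K KD unfolding maximal_in_def by blast
  then show ?thesis
  proof cases
    case 1
    then show ?thesis using DD D by blast
  next
    case 2
    have "Y \<subseteq> D"
    proof
      fix y assume y: "y \<in> Y"
      then obtain d k where dk: "d \<in> D" "k \<in> K" "y = d \<otimes> k"
        using 2 Y(2) unfolding set_mult_def by blast
      then have "k = inv d \<otimes> y"
        using subgroup.mem_carrier[OF sD] subgroup.mem_carrier[OF sK]
        by (simp add: m_assoc[symmetric])
      then have "k \<in> Y"
        using dk y D(3) subgroup.m_closed[OF sY] subgroup.m_inv_closed[OF sY] by blast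
      then show "y \<in> D" using dk D(2) subgroup.m_closed[OF sD] by blast
    qed
    then show ?thesis using D(3) by blast
  qed
qed

text \<open>
  This is the analogue of the exchange property of hyperplanes: if \<open>K\<close> does not contain \<open>Y\<close>
  but contains \<open>Y \<inter> K'\<close>, then the roles of \<open>K\<close> and \<open>K'\<close> relative to \<open>Y\<close> can be
  swapped, because \<open>Y \<inter> K\<close> is then squeezed between \<open>Y \<inter> K'\<close> and \<open>Y\<close>.
\<close>

lemma exchange:
  assumes "K \<lhd> G" "K' \<in> maximal_in N'" "N' \<in> open_normal"
    and Y: "Y \<lhd> G" "Y \<subseteq> N'" "\<not> Y \<subseteq> K" and "Y \<inter> K' \<subseteq> K"
  shows "Y \<inter> K \<subseteq> K'"
proof -
  have "Y \<inter> K \<lhd> G" using normal_subgroup_intersect[OF Y(1) assms(1)] .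
  then have "Y \<inter> K = Y \<inter> K' \<or> Y \<inter> K = Y"
    using assms by (intro no_normal_subgroup_between[OF assms(2,3)]) auto
  then show ?thesis using Y(3) by blast
qed

definition independent_over :: "'a set set \<Rightarrow> 'a set set \<Rightarrow> bool" where
  "independent_over \<P> \<M> \<longleftrightarrow> (\<forall>K \<in> \<M>. \<not> meet (\<P> \<union> (\<M> - {K})) \<subseteq> K)"

text \<open>
  Dependence has finite character by compactness: a dependence in the union involves only
  finitely many members of the family, and these lie in a single member of the chain.
\<close>

lemma independent_over_Union_chain:
  assumes chain: "subset.chain {\<M>. \<M> \<subseteq> open_normal \<and> independent_over \<P> \<M>} \<C>"
    and \<P>: "\<P> \<subseteq> open_normal" and "\<C> \<noteq> {}"
  shows "independent_over \<P> (\<Union>\<C>)"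
  unfolding independent_over_def
proof (intro ballI notI)
  fix K assume K: "K \<in> \<Union>\<C>" and le: "meet (\<P> \<union> (\<Union>\<C> - {K})) \<subseteq> K"
  have \<C>: "\<M> \<subseteq> open_normal" "independent_over \<P> \<M>" if "\<M> \<in> \<C>" for \<M>
    using chain that unfolding subset_chain_def by auto
  have "\<P> \<union> (\<Union>\<C> - {K}) \<subseteq> open_normal" "openin T K"
    using \<P> \<C>(1) K open_normalD(3) by blast+
  then obtain \<E> where \<E>: "finite \<E>" "\<E> \<subseteq> \<P> \<union> (\<Union>\<C> - {K})" "meet \<E> \<subseteq> K"
    using compact_meet le by metis
  have "finite (insert K (\<E> - \<P>))" "insert K (\<E> - \<P>) \<subseteq> \<Union>\<C>" using \<E> K by auto
  then obtain \<M> where \<M>: "\<M> \<in> \<C>" "insert K (\<E> - \<P>) \<subseteq> \<M>"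
    using finite_subset_Union_chain[OF _ _ \<open>\<C> \<noteq> {}\<close> chain] by metis
  have "meet (\<P> \<union> (\<M> - {K})) \<subseteq> meet \<E>" using \<M> \<E>(2) unfolding meet_def by blast
  then show False using \<E>(3) \<M> \<C>(2) unfolding independent_over_def by blast
qed

text \<open>
  A maximal independent family \<open>\<M>\<close> spans: if \<open>K'\<close> did not contain the intersection, the
  family enlarged by \<open>K'\<close> would be dependent at some \<open>K \<in> \<M>\<close>, and exchanging \<open>K\<close>
  for \<open>K'\<close> would make \<open>K'\<close> contain the intersection after all.
\<close>

lemma exists_spanning_independent:
  assumes \<P>: "\<P> \<subseteq> open_normal"
  shows "\<exists>\<M> \<subseteq> (\<Union>N\<in>\<P>. maximal_in N). independent_over \<P> \<M> \<and>
    (\<forall>K \<in> (\<Union>N\<in>\<P>. maximal_in N). meet (\<P> \<union> \<M>) \<subseteq> K)"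
proof -
  let ?K = "\<Union>N\<in>\<P>. maximal_in N"
  let ?A = "{\<M>. \<M> \<subseteq> ?K \<and> independent_over \<P> \<M>}"
  have K_on: "?K \<subseteq> open_normal" unfolding maximal_in_def by blast
  have "{} \<in> ?A" unfolding independent_over_def by simp
  then have "\<exists>\<M>\<in>?A. \<forall>X\<in>?A. \<M> \<subseteq> X \<longrightarrow> X = \<M>"
  proof (intro subset_Zorn_nonempty)
    fix \<C> assume "\<C> \<noteq> {}" and ch: "subset.chain ?A \<C>"
    have "?A \<subseteq> {\<M>. \<M> \<subseteq> open_normal \<and> independent_over \<P> \<M>}" using K_on by auto
    then have "subset.chain {\<M>. \<M> \<subseteq> open_normal \<and> independent_over \<P> \<M>} \<C>"
      using ch unfolding subset_chain_def by (meson order_trans)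
    then have "independent_over \<P> (\<Union>\<C>)"
      using \<P> \<open>\<C> \<noteq> {}\<close> by (rule independent_over_Union_chain)
    moreover have "\<Union>\<C> \<subseteq> ?K" using ch unfolding subset_chain_def by (auto 0 3)
    ultimately show "\<Union>\<C> \<in> ?A" by simp
  qed auto
  then obtain \<M> where "\<M> \<in> ?A" and max: "\<forall>X\<in>?A. \<M> \<subseteq> X \<longrightarrow> X = \<M>"
    by (elim bexE)
  then have \<M>: "\<M> \<subseteq> ?K" "independent_over \<P> \<M>" by simp_all
  have "meet (\<P> \<union> \<M>) \<subseteq> K'" if K': "K' \<in> ?K" for K'
  proof (rule ccontr)
    assume nle: "\<not> meet (\<P> \<union> \<M>) \<subseteq> K'"
    then have nin: "K' \<notin> \<M>" unfolding meet_def by blast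
    then have "\<not> independent_over \<P> (insert K' \<M>)"
      using bspec[OF max, of "insert K' \<M>"] K' \<M>(1) by auto
    then obtain K where K: "K \<in> insert K' \<M>" "meet (\<P> \<union> (insert K' \<M> - {K})) \<subseteq> K"
      unfolding independent_over_def by blast
    \<comment> \<open>At \<open>K'\<close> itself the family is not dependent, by the choice of \<open>K'\<close>.\<close>
    have "K \<noteq> K'" using K(2) nle nin by auto
    then have KM: "K \<in> \<M>" using K(1) by blast
    have M_on: "\<M> \<subseteq> open_normal" using \<M>(1) K_on by (rule order_trans)
    define Y where "Y = meet (\<P> \<union> (\<M> - {K}))"
    have "Y \<inter> K' \<subseteq> meet (\<P> \<union> (insert K' \<M> - {K}))" unfolding Y_def meet_def by auto
    then have YK': "Y \<inter> K' \<subseteq> K" using K(2) by (rule order_trans)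
    have YK: "\<not> Y \<subseteq> K" using \<M>(2) KM unfolding Y_def independent_over_def by simp
    have "\<P> \<union> (\<M> - {K}) \<subseteq> open_normal" using \<P> M_on by auto
    then have "Y \<lhd> G" unfolding Y_def by (intro normal_meet open_normalD(1)) auto
    obtain N' where N': "N' \<in> \<P>" "K' \<in> maximal_in N'" using K' by blast
    have "N' \<in> open_normal" using \<P> N'(1) by (rule subsetD)
    have "Y \<subseteq> N'" using N'(1) unfolding Y_def meet_def by auto
    have "K \<lhd> G" using subsetD[OF M_on KM] by (rule open_normalD(1))
    have "Y \<inter> K \<subseteq> K'"
      using exchange[OF \<open>K \<lhd> G\<close> N'(2) \<open>N' \<in> open_normal\<close> \<open>Y \<lhd> G\<close> \<open>Y \<subseteq> N'\<close> YK YK'] .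
    moreover have "meet (\<P> \<union> \<M>) \<subseteq> Y \<inter> K" using KM unfolding Y_def meet_def by auto
    ultimately show False using nle by blast
  qed
  then show ?thesis using \<M> by (intro exI[of _ \<M>]) simp
qed

text \<open>
  The subfamily \<open>\<S>\<close> is recovered from the intersection as the set of those members of
  \<open>\<M>\<close> that contain it.
\<close>

lemma inj_on_meet_independent:
  assumes "independent_over \<P> \<M>"
  shows "inj_on (\<lambda>\<S>. meet (\<P> \<union> \<S>)) (Pow \<M>)"
proof -
  have "K \<in> \<S> \<longleftrightarrow> meet (\<P> \<union> \<S>) \<subseteq> K" if "K \<in> \<M>" "\<S> \<subseteq> \<M>" for K \<S>
  proof
    show "meet (\<P> \<union> \<S>) \<subseteq> K" if "K \<in> \<S>" using that unfolding meet_def by blast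
    show "K \<in> \<S>" if le: "meet (\<P> \<union> \<S>) \<subseteq> K"
    proof (rule ccontr)
      assume "K \<notin> \<S>"
      then have "meet (\<P> \<union> (\<M> - {K})) \<subseteq> meet (\<P> \<union> \<S>)"
        using \<open>\<S> \<subseteq> \<M>\<close> unfolding meet_def by blast
      then show False using le assms \<open>K \<in> \<M>\<close> unfolding independent_over_def by blast
    qed
  qed
  then have "\<S> = {K \<in> \<M>. meet (\<P> \<union> \<S>) \<subseteq> K}" if "\<S> \<subseteq> \<M>" for \<S>
    using that by blast
  then show ?thesis
    by (intro inj_on_inverseI[where g = "\<lambda>H. {K \<in> \<M>. H \<subseteq> K}"]) simp
qed

lemma maximal_in_minimal_overgroup:
  assumes "N \<in> open_normal" "N \<noteq> carrier G"
  obtains M where "M \<in> open_normal" "N \<in> maximal_in M"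
proof -
  let ?S = "{M \<in> open_normal. N \<subset> M}"
  have "?S \<subseteq> {M. subgroup M G \<and> N \<subseteq> M}" using open_normalD(2) by blast
  then have "finite ?S"
    using finite_overgroups[OF open_normalD(2,3)[OF assms(1)]] by (rule finite_subset)
  moreover have "carrier G \<in> ?S"
    using assms open_normalD(5) carrier_open_normal by blast
  ultimately obtain M where "M \<in> ?S" "\<forall>D\<in>?S. D \<subseteq> M \<longrightarrow> M = D"
    using finite_has_minimal[of ?S] by blast
  then have "N \<in> maximal_in M" using assms(1) unfolding maximal_in_def by blast
  then show thesis using that \<open>M \<in> ?S\<close> by blast
qed

text \<open>
  The \<open>n\<close>-th level consists of the open normal subgroups at which some chief series starting
  from \<open>G\<close> arrives after \<open>n\<close> steps.
\<close>

primrec chief_level :: "nat \<Rightarrow> 'a set set" where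
  "chief_level 0 = {carrier G}"
| "chief_level (Suc n) = (\<Union>N\<in>chief_level n. maximal_in N)"

text \<open>
  Climbing from \<open>N\<close> to a minimal open normal subgroup above it terminates, because only
  finitely many subgroups lie above \<open>N\<close>.
\<close>

lemma Union_chief_level: "(\<Union>n. chief_level n) = open_normal"
proof (intro equalityI subsetI)
  fix N assume "N \<in> (\<Union>n. chief_level n)"
  then obtain n where "N \<in> chief_level n" by blast
  then show "N \<in> open_normal"
    by (cases n) (auto simp: carrier_open_normal maximal_in_def)
next
  fix N assume "N \<in> open_normal"
  then show "N \<in> (\<Union>n. chief_level n)"
  proof (induction "card {M \<in> open_normal. N \<subseteq> M}" arbitrary: N rule: less_induct)
    case less
    show ?case
    proof (cases "N = carrier G")
      case True
      then have "N \<in> chief_level 0" by simp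
      then show ?thesis by blast
    next
      case False
      obtain M where M: "M \<in> open_normal" "N \<in> maximal_in M"
        using maximal_in_minimal_overgroup[OF less.prems False] .
      have "{U \<in> open_normal. N \<subseteq> U} \<subseteq> {U. subgroup U G \<and> N \<subseteq> U}"
        using open_normalD(2) by blast
      then have fin: "finite {U \<in> open_normal. N \<subseteq> U}"
        using finite_overgroups[OF open_normalD(2,3)[OF less.prems]] by (rule finite_subset)
      have "{U \<in> open_normal. M \<subseteq> U} \<subset> {U \<in> open_normal. N \<subseteq> U}"
        using M(2) less.prems unfolding maximal_in_def by blast
      then have "card {U \<in> open_normal. M \<subseteq> U} < card {U \<in> open_normal. N \<subseteq> U}"
        using psubset_card_mono[OF fin] by blast
      then obtain n where "M \<in> chief_level n" using less.hyps[OF _ M(1)] by blast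
      then have "N \<in> chief_level (Suc n)" using M(2) by auto
      then show ?thesis by blast
    qed
  qed
qed

lemma card_of_Pow_open_normal_le:
  assumes unc: "\<not> countable open_normal"
  shows "|Pow open_normal| \<le>o |closed_normal_subgroups G T|"
proof -
  have "\<exists>\<P>\<subseteq>open_normal. |\<P>| <o |open_normal| \<and> |open_normal| \<le>o |\<Union>N\<in>\<P>. maximal_in N|"
    using small_set_with_large_neighbourhood[of chief_level maximal_in,
        unfolded Union_chief_level, OF unc] by simp
  then obtain \<P> where \<P>: "\<P> \<subseteq> open_normal" "|\<P>| <o |open_normal|"
    "|open_normal| \<le>o |\<Union>N\<in>\<P>. maximal_in N|"
    by (elim exE conjE)
  let ?K = "\<Union>N\<in>\<P>. maximal_in N"
  from exists_spanning_independent[OF \<P>(1)]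
  obtain \<M> where \<M>: "\<M> \<subseteq> ?K" "independent_over \<P> \<M>"
    and span: "\<forall>K\<in>?K. meet (\<P> \<union> \<M>) \<subseteq> K"
    by (elim exE conjE)
  have K_on: "?K \<subseteq> open_normal" unfolding maximal_in_def by blast
  then have PM: "\<P> \<union> \<M> \<subseteq> open_normal" using \<P>(1) \<M>(1) by simp
  \<comment> \<open>If \<open>\<M>\<close> were small, too few open normal subgroups would lie above the intersection.\<close>
  have \<M>_large: "|open_normal| \<le>o |\<M>|"
  proof (rule ccontr)
    assume "\<not> ?thesis"
    then have "|\<M>| <o |open_normal|" by (simp add: card_of_less_iff_not_ge)
    moreover have "infinite open_normal" using unc countable_finite by blast
    ultimately have "|\<P> \<union> \<M>| <o |open_normal|"
      using \<P>(2) card_of_Un_ordLess_infinite by metis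
    from infinite_superset_of_smaller_card[OF unc this]
    obtain B where B: "\<P> \<union> \<M> \<subseteq> B" "infinite B" "|B| <o |open_normal|" .
    have "?K \<subseteq> {U \<in> open_normal. meet (\<P> \<union> \<M>) \<subseteq> U}"
      using span K_on by auto
    then have "|?K| \<le>o |{U \<in> open_normal. meet (\<P> \<union> \<M>) \<subseteq> U}|" by (rule card_of_mono1)
    also have "|{U \<in> open_normal. meet (\<P> \<union> \<M>) \<subseteq> U}| \<le>o |B|"
      using B(2) PM card_of_mono1[OF B(1)] by (rule card_of_open_normal_above_meet)
    finally have "|open_normal| \<le>o |B|" using \<P>(3) by (rule ordLeq_transitive[rotated])
    then show False using B(3) by (simp add: card_of_less_iff_not_ge)
  qed
  have "(\<lambda>\<S>. meet (\<P> \<union> \<S>)) ` Pow \<M> \<subseteq> closed_normal_subgroups G T"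
  proof (intro image_subsetI meet_closed_normal)
    fix \<S> assume "\<S> \<in> Pow \<M>"
    then show "\<P> \<union> \<S> \<subseteq> open_normal" using PM by auto
  qed
  with inj_on_meet_independent[OF \<M>(2)] have "|Pow \<M>| \<le>o |closed_normal_subgroups G T|"
    unfolding card_of_ordLeq[symmetric] by (intro exI conjI)
  with card_of_Pow_mono[OF \<M>_large] show ?thesis by (rule ordLeq_transitive)
qed

section \<open>Cosets as a base\<close>

text \<open>
  The elements \<open>g\<close> that may be inserted into or deleted from any product \<open>x g y\<close> without
  affecting membership in \<open>U\<close> form a normal subgroup, by pure algebra (a two-sided syntactic
  congruence). Its complement is the projection, along the compact space of pairs \<open>(x, y)\<close>, of a set
  that is closed because \<open>U\<close> is clopen; so the subgroup is open.
\<close>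

lemma open_normal_inside_clopen:
  assumes U: "closedin T U" "openin T U" "\<one> \<in> U"
  obtains N where "N \<in> open_normal" "N \<subseteq> U"
proof -
  define N where "N = {g \<in> carrier G. \<forall>x\<in>carrier G. \<forall>y\<in>carrier G. x \<otimes> g \<otimes> y \<in> U \<longleftrightarrow> x \<otimes> y \<in> U}"
  have sub: "subgroup N G"
  proof (rule subgroupI)
    show "N \<subseteq> carrier G" unfolding N_def by blast
    have "\<one> \<in> N" unfolding N_def by simp
    then show "N \<noteq> {}" by blast
  next
    fix a assume a: "a \<in> N"
    then have ac: "a \<in> carrier G" unfolding N_def by blast
    have "x \<otimes> inv a \<otimes> y \<in> U \<longleftrightarrow> x \<otimes> y \<in> U" if xy: "x \<in> carrier G" "y \<in> carrier G" for x y
    proof -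
      have "(x \<otimes> inv a) \<otimes> a \<otimes> y \<in> U \<longleftrightarrow> (x \<otimes> inv a) \<otimes> y \<in> U"
        using a ac xy unfolding N_def by blast
      then show ?thesis using ac xy by (simp add: m_assoc)
    qed
    then show "inv a \<in> N" using ac unfolding N_def by simp
  next
    fix a b assume ab: "a \<in> N" "b \<in> N"
    then have c: "a \<in> carrier G" "b \<in> carrier G" unfolding N_def by auto
    have "x \<otimes> (a \<otimes> b) \<otimes> y \<in> U \<longleftrightarrow> x \<otimes> y \<in> U" if xy: "x \<in> carrier G" "y \<in> carrier G" for x y
    proof -
      have "x \<otimes> a \<otimes> (b \<otimes> y) \<in> U \<longleftrightarrow> x \<otimes> (b \<otimes> y) \<in> U"
        using ab(1) c xy unfolding N_def by blast
      moreover have "x \<otimes> b \<otimes> y \<in> U \<longleftrightarrow> x \<otimes> y \<in> U"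
        using ab(2) xy unfolding N_def by blast
      ultimately show ?thesis using c xy by (simp add: m_assoc)
    qed
    then show "a \<otimes> b \<in> N" using c unfolding N_def by simp
  qed
  have "N \<lhd> G" unfolding normal_inv_iff
  proof (intro conjI ballI sub)
    fix z g assume z: "z \<in> carrier G" and g: "g \<in> N"
    then have gc: "g \<in> carrier G" unfolding N_def by blast
    have "x \<otimes> (z \<otimes> g \<otimes> inv z) \<otimes> y \<in> U \<longleftrightarrow> x \<otimes> y \<in> U" if xy: "x \<in> carrier G" "y \<in> carrier G" for x y
    proof -
      have "(x \<otimes> z) \<otimes> g \<otimes> (inv z \<otimes> y) \<in> U \<longleftrightarrow> (x \<otimes> z) \<otimes> (inv z \<otimes> y) \<in> U"
        using g z xy unfolding N_def by blast
      moreover have "(x \<otimes> z) \<otimes> (inv z \<otimes> y) = x \<otimes> y"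
        using z xy by (metis inv_closed m_assoc m_closed l_one r_inv)
      ultimately show ?thesis using z gc xy by (simp add: m_assoc)
    qed
    then show "z \<otimes> g \<otimes> inv z \<in> N" using z gc unfolding N_def by simp
  qed
  moreover have "openin T N"
  proof -
    \<comment> \<open>A point of \<open>?P\<close> is \<open>((x, y), g)\<close>; it lies in \<open>?A\<close> if \<open>x g y \<in> U\<close> and in \<open>?B\<close> if \<open>x y \<in> U\<close>.\<close>
    let ?P = "prod_topology (prod_topology T T) T"
    have m: "continuous_map ?P T (\<lambda>p. f p \<otimes> h p)"
      if "continuous_map ?P T f" "continuous_map ?P T h" for f h
    proof -
      have "continuous_map ?P T ((\<lambda>(x, y). x \<otimes> y) \<circ> (\<lambda>p. (f p, h p)))"
        using that by (intro continuous_map_compose[OF _ continuous_mult] continuous_map_pairedI)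
      then show ?thesis by (simp add: o_def)
    qed
    have c1: "continuous_map ?P T (\<lambda>p. fst (fst p))" "continuous_map ?P T (\<lambda>p. snd (fst p))"
      "continuous_map ?P T snd"
      using continuous_map_compose[OF continuous_map_fst continuous_map_fst, of T T T]
        continuous_map_compose[OF continuous_map_fst continuous_map_snd, of T T T]
        continuous_map_snd unfolding o_def .
    let ?A = "{p \<in> topspace ?P. fst (fst p) \<otimes> snd p \<otimes> snd (fst p) \<in> U}"
    let ?B = "{p \<in> topspace ?P. fst (fst p) \<otimes> snd (fst p) \<in> U}"
    have cont: "continuous_map ?P T (\<lambda>p. fst (fst p) \<otimes> snd p \<otimes> snd (fst p))"
        "continuous_map ?P T (\<lambda>p. fst (fst p) \<otimes> snd (fst p))"
      by (rule m[OF m[OF c1(1,3)] c1(2)], rule m[OF c1(1,2)])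
    have "closedin ?P ?A" "openin ?P ?A" "closedin ?P ?B" "openin ?P ?B"
      using closedin_continuous_map_preimage[OF cont(1) U(1)]
        openin_continuous_map_preimage[OF cont(1) U(2)]
        closedin_continuous_map_preimage[OF cont(2) U(1)]
        openin_continuous_map_preimage[OF cont(2) U(2)] .
    then have "closedin ?P ((?A - ?B) \<union> (?B - ?A))"
      by (intro closedin_Un closedin_diff) assumption+
    moreover have "closed_map ?P T snd"
      using compact by (intro closed_map_snd) (simp add: compact_space_prod_topology)
    ultimately have "closedin T (snd ` ((?A - ?B) \<union> (?B - ?A)))"
      unfolding closed_map_def by blast
    moreover have "N = topspace T - snd ` ((?A - ?B) \<union> (?B - ?A))"
    proof (intro equalityI subsetI)
      fix g assume "g \<in> N"
      then show "g \<in> topspace T - snd ` ((?A - ?B) \<union> (?B - ?A))"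
        unfolding N_def by (auto simp: topspace_eq)
    next
      fix g assume g: "g \<in> topspace T - snd ` ((?A - ?B) \<union> (?B - ?A))"
      have "x \<otimes> g \<otimes> y \<in> U \<longleftrightarrow> x \<otimes> y \<in> U" if "x \<in> carrier G" "y \<in> carrier G" for x y
      proof -
        have "((x, y), g) \<notin> (?A - ?B) \<union> (?B - ?A)" using g by force
        then show ?thesis using that g by (simp add: topspace_eq) blast
      qed
      then show "g \<in> N" using g unfolding N_def by (simp add: topspace_eq)
    qed
    ultimately show ?thesis by (simp add: openin_diff)
  qed
  moreover have "N \<subseteq> U"
  proof
    fix g assume g: "g \<in> N"
    then have "\<one> \<otimes> g \<otimes> \<one> \<in> U \<longleftrightarrow> \<one> \<otimes> \<one> \<in> U" unfolding N_def by blast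
    then show "g \<in> U" using U(3) g unfolding N_def by simp
  qed
  ultimately show thesis using that unfolding open_normal_def by blast
qed

definition open_cosets :: "'a set set" where
  "open_cosets = (\<Union>N\<in>open_normal. rcosets N)"

lemma card_of_open_cosets_le:
  assumes "infinite open_normal"
  shows "|open_cosets| \<le>o |open_normal|"
  unfolding open_cosets_def
proof (intro card_of_UNION_ordLeq_infinite ballI assms)
  fix N assume "N \<in> open_normal"
  then have "finite (rcosets N)" using finite_rcosets_open_subgroup open_normalD by blast
  then show "|rcosets N| \<le>o |open_normal|"
    using assms by (rule card_of_finite_le_infinite)
qed (rule ordLeq_refl[OF card_of_Card_order])

end

locale profinite = compact_group +
  assumes hausdorff: "Hausdorff_space T"
    and totally_disconnected: "totally_disconnected_space T"
begin

text \<open>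
  In a compact Hausdorff space a connected component, here a point, can be separated from any
  disjoint closed set by a partition into two open sets.
\<close>

lemma clopen_neighbourhood:
  assumes "openin T V" "x \<in> V"
  obtains U where "closedin T U" "openin T U" "x \<in> U" "U \<subseteq> V"
proof -
  have x: "x \<in> topspace T" using assms openin_subset by blast
  then have comp: "connected_component_of_set T x = {x}"
    using totally_disconnected unfolding totally_disconnected_space_def by blast
  have "separated_between T {x} (topspace T - V)"
  proof (rule separated_between_compact_connected_component)
    show "{x} \<in> connected_components_of T"
      using x comp unfolding connected_components_of_def by (metis image_eqI)
    show "locally_compact_space T" using compact compact_imp_locally_compact_space by blast
  qed (use hausdorff x assms in auto)
  then obtain U W where "openin T U" "openin T W" "U \<union> W = topspace T" "disjnt U W"
    "x \<in> U" "topspace T - V \<subseteq> W"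
    unfolding separated_between_def by auto
  moreover from this have "U = topspace T - W" unfolding disjnt_def by blast
  ultimately show thesis using that[of U] by auto
qed

lemma topology_base_open_cosets: "topology_base T open_cosets"
  unfolding topology_base_def
proof (intro conjI ballI allI impI)
  fix c assume "c \<in> open_cosets"
  then show "openin T c"
    using openin_rcosets open_normalD(3) unfolding open_cosets_def by blast
next
  fix V x assume V: "openin T V \<and> x \<in> V"
  then have x: "x \<in> carrier G" using openin_subset topspace_eq by blast
  have Vc: "V \<subseteq> carrier G" using V openin_subset topspace_eq by blast
  have "openin T (V #> inv x)" using V x openin_r_coset by simp
  moreover have "\<one> \<in> V #> inv x" using V x unfolding r_coset_def by force
  ultimately obtain U where "closedin T U" "openin T U" "\<one> \<in> U" "U \<subseteq> V #> inv x"
    using clopen_neighbourhood by blast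
  then obtain N where N: "N \<in> open_normal" "N \<subseteq> V #> inv x"
    using open_normal_inside_clopen by (metis order_trans)
  have "N #> x \<subseteq> (V #> inv x) #> x" using N(2) unfolding r_coset_def by blast
  also have "\<dots> = V" using Vc x by (simp add: coset_mult_assoc)
  finally have "N #> x \<subseteq> V" .
  moreover have "x \<in> N #> x" using rcos_self[OF x open_normalD(2)[OF N(1)]] .
  moreover have "N #> x \<in> open_cosets"
    using N(1) x unfolding open_cosets_def RCOSETS_def by blast
  ultimately show "\<exists>W\<in>open_cosets. x \<in> W \<and> W \<subseteq> V" by blast
qed

lemma uncountable_open_normal:
  assumes "\<not> second_countable T"
  shows "\<not> countable open_normal"
proof
  assume "countable open_normal"
  moreover have "countable (rcosets N)" if "N \<in> open_normal" for N
    using finite_rcosets_open_subgroup[OF open_normalD(2,3)[OF that]] by (rule countable_finite)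
  ultimately have "countable open_cosets" unfolding open_cosets_def by (rule countable_UN)
  then show False
    using assms topology_base_open_cosets second_countable_iff_base by blast
qed

lemma weight_le_open_normal:
  assumes "infinite open_normal"
  shows "weight T \<le>o |open_normal|"
  using weight_least[OF topology_base_open_cosets] card_of_open_cosets_le[OF assms]
  by (rule ordLeq_transitive)

end

lemma profinite_groupD:
  assumes "profinite_group G T"
  shows "profinite G T"
  using assms unfolding profinite_group_def topological_group_def
  by (intro profinite.intro compact_group.intro compact_group_axioms.intro profinite_axioms.intro)
    auto

section \<open>Closed sets and the weight\<close>

text \<open>
  The complement of a closed set \<open>C\<close> is the union of the basic open sets disjoint from \<open>C\<close>.
\<close>

lemma card_of_closed_sets_le:
  "|{C. closedin T C}| \<le>o ctwo ^c weight T"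
proof -
  obtain \<B> where \<B>: "topology_base T \<B>" "weight T = |\<B>|"
    using weight_attained by blast
  have recover: "topspace T - \<Union>{V \<in> \<B>. V \<inter> C = {}} = C" if C: "closedin T C" for C
  proof (intro equalityI subsetI)
    fix x assume x: "x \<in> topspace T - \<Union>{V \<in> \<B>. V \<inter> C = {}}"
    show "x \<in> C"
    proof (rule ccontr)
      assume "x \<notin> C"
      then have "openin T (topspace T - C)" "x \<in> topspace T - C"
        using C x by auto
      then obtain V where "V \<in> \<B>" "x \<in> V" "V \<subseteq> topspace T - C"
        using \<B>(1) unfolding topology_base_def by meson
      then show False using x by auto
    qed
  next
    fix x assume "x \<in> C"
    then show "x \<in> topspace T - \<Union>{V \<in> \<B>. V \<inter> C = {}}"
      using closedin_subset[OF C] by auto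
  qed
  have "inj_on (\<lambda>C. {V \<in> \<B>. V \<inter> C = {}}) {C. closedin T C}"
    by (rule inj_on_inverseI[where g = "\<lambda>\<A>. topspace T - \<Union>\<A>"])
      (simp only: recover mem_Collect_eq)
  moreover have "(\<lambda>C. {V \<in> \<B>. V \<inter> C = {}}) ` {C. closedin T C} \<subseteq> Pow \<B>" by auto
  ultimately have "|{C. closedin T C}| \<le>o |Pow \<B>|"
    unfolding card_of_ordLeq[symmetric] by (intro exI conjI)
  also have "|Pow \<B>| =o ctwo ^c |\<B>|" by (rule card_of_Pow_eq_cexp_ctwo)
  finally show ?thesis using \<B>(2) by simp
qed

theorem theorem6p9:
  fixes G :: "('a, 'b) monoid_scheme" and T :: "'a topology"
  assumes "profinite_group G T"
    and "\<not> second_countable T"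
  shows "|closed_subgroups G T| =o |closed_normal_subgroups G T| \<and>
         |closed_normal_subgroups G T| =o ctwo ^c weight T"
proof -
  interpret profinite G T using assms(1) by (rule profinite_groupD)
  let ?\<S> = "closed_subgroups G T" and ?\<N> = "closed_normal_subgroups G T"
  have unc: "\<not> countable open_normal" using uncountable_open_normal[OF assms(2)] .
  obtain \<B> :: "'a set set" where \<B>: "weight T = |\<B>|" using weight_attained by blast
  have "|\<B>| \<le>o |open_normal|"
    using weight_le_open_normal unc countable_finite unfolding \<B> by blast
  then have "|Pow \<B>| \<le>o |Pow open_normal|" by (rule card_of_Pow_mono)
  have "ctwo ^c weight T =o |Pow \<B>|"
    unfolding \<B> using card_of_Pow_eq_cexp_ctwo by (rule ordIso_symmetric)
  also note \<open>|Pow \<B>| \<le>o |Pow open_normal|\<close>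
  also have "|Pow open_normal| \<le>o |?\<N>|" using card_of_Pow_open_normal_le[OF unc] .
  finally have lower: "ctwo ^c weight T \<le>o |?\<N>|" .
  have mono: "|?\<N>| \<le>o |?\<S>|"
    by (intro card_of_mono1) (auto simp: closed_subgroups_def closed_normal_subgroups_def
        normal_imp_subgroup)
  have "|?\<S>| \<le>o |{C. closedin T C}|"
    by (intro card_of_mono1) (auto simp: closed_subgroups_def)
  then have upper: "|?\<S>| \<le>o ctwo ^c weight T"
    using card_of_closed_sets_le by (rule ordLeq_transitive)
  have "|?\<S>| \<le>o |?\<N>|" using upper lower by (rule ordLeq_transitive)
  moreover have "|?\<N>| \<le>o ctwo ^c weight T" using mono upper by (rule ordLeq_transitive)
  ultimately show ?thesis using lower mono by (simp add: ordIso_iff_ordLeq)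
qed

end
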